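(* Let $\mathsf{R}'_{\mathrm{PWK}}$ be the single-conclusion Hilbert-style system over the language $L$ given below, and let $\vdash_{\mathrm{PWK}}$ be Paraconsistent Weak Kleene logic. Then $\vdash_{\mathsf{R}'_{\mathrm{PWK}}} \;=\; \vdash_{\mathrm{PWK}}$, i.e. for all $\Gamma\cup\{\varphi\}\subseteq L$, $\Gamma\vdash_{\mathsf{R}'_{\mathrm{PWK}}}\varphi$ iff $\Gamma\vdash_{\mathrm{PWK}}\varphi$.
   Context: $L$ is the set of formulas built from a countably infinite set of propositional variables using binary connectives $\land,\lor$ and unary $\neg$. Let $\mathbf{A}$ be the algebra on $\{f,u,t\}$ in which each connective, applied to arguments all in $\{f,t\}$, returns the classical Boolean value (with $f$ = false, $t$ = true), and returns $u$ whenever at least one argument is $u$. A valuation is a homomorphism $v$ from the formula algebra into $\mathbf{A}$. $\Gamma\vdash_{\mathrm{PWK}}\varphi$ iff there is no valuation $v$ with $v[\Gamma]\subseteq\{u,t\}$ and $v(\varphi)=f$. A single-conclusion (Set-Fmla) Hilbert system is given by rule schemas $\gamma_1,\dots,\gamma_m/\varphi$ ($m\ge 0$); their instances are obtained by applying arbitrary substitutions (endomorphisms of the formula algebra). $\Gamma\vdash_{\mathsf R}\varphi$ iff there is a finite sequence of formulas ending in $\varphi$ each member of which is in $\Gamma$ or is the conclusion of a rule instance whose premises all occur earlier in the sequence. The rule schemas of $\mathsf{R}'_{\mathrm{PWK}}$ (with $p,q,r$ distinct variables) are: $\varnothing/p\lor\neg p$; $p\lor r/\neg\neg p\lor r$;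 $\neg\neg p\lor r/p\lor r$; $p\lor r,\,q\lor r/(p\land q)\lor r$; $(p\land q)\lor r/(p\lor q)\lor r$; $(p\land q)\lor r/(p\lor\neg q)\lor r$; $(p\land q)\lor r/(\neg p\lor q)\lor r$; $\neg(p\land q)\lor r/(\neg p\lor\neg q)\lor r$; $p\lor r,\,\neg p\lor r/(p\land q)\lor r$; $\neg p\lor r/\neg(p\land q)\lor r$; $q\lor r,\,\neg q\lor r/(p\land q)\lor r$; $\neg q\lor r/\neg(p\land q)\lor r$; $p\lor r/(p\lor q)\lor r$; $q\lor r/(p\lor q)\lor r$; $\neg(p\lor q)\lor r/(p\lor\neg q)\lor r$; $\neg(p\lor q)\lor r/(\neg p\lor q)\lor r$; $\neg(p\lor q)\lor r/(\neg p\lor\neg q)\lor r$; $p\lor r,\,\neg p\lor r/\neg(p\lor q)\lor r$; $q\lor r,\,\neg q\lor r/\neg(p\lor q)\lor r$; $p\lor p/p$; $p/p\lor q$; $p\lor q/q\lor p$; $p\lor(q\lor r)/(p\lor q)\lor r$. *)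

theory Defs
  imports Main
begin

datatype fm =
    Var nat
  | Conj fm fm  (infixr \<open>\<^bold>\<and>\<close> 75)
  | Disj fm fm  (infixr \<open>\<^bold>\<or>\<close> 70)
  | Neg fm      (\<open>\<^bold>\<not> _\<close> [80] 80)

datatype tv = F | U | T

definition of_bool_tv :: "bool \<Rightarrow> tv" where
  "of_bool_tv b = (if b then T else F)"

definition conj_tv :: "tv \<Rightarrow> tv \<Rightarrow> tv" where
  "conj_tv x y = (if x = U \<or> y = U then U else of_bool_tv (x = T \<and> y = T))"

definition disj_tv :: "tv \<Rightarrow> tv \<Rightarrow> tv" where
  "disj_tv x y = (if x = U \<or> y = U then U else of_bool_tv (x = T \<or> y = T))"

definition neg_tv :: "tv \<Rightarrow> tv" where
  "neg_tv x = (if x = U then U else of_bool_tv (\<not> x = T))"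

definition valuation :: "(fm \<Rightarrow> tv) \<Rightarrow> bool" where
  "valuation v \<longleftrightarrow>
     (\<forall>a b. v (a \<^bold>\<and> b) = conj_tv (v a) (v b)) \<and>
     (\<forall>a b. v (a \<^bold>\<or> b) = disj_tv (v a) (v b)) \<and>
     (\<forall>a. v (\<^bold>\<not> a) = neg_tv (v a))"

definition pwk :: "fm set \<Rightarrow> fm \<Rightarrow> bool"  (infix \<open>\<turnstile>\<^sub>P\<^sub>W\<^sub>K\<close> 50) where
  "\<Gamma> \<turnstile>\<^sub>P\<^sub>W\<^sub>K \<phi> \<longleftrightarrow> (\<nexists>v. valuation v \<and> v ` \<Gamma> \<subseteq> {U, T} \<and> v \<phi> = F)"

definition substitution :: "(fm \<Rightarrow> fm) \<Rightarrow> bool" where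
  "substitution s \<longleftrightarrow>
     (\<forall>a b. s (a \<^bold>\<and> b) = s a \<^bold>\<and> s b) \<and>
     (\<forall>a b. s (a \<^bold>\<or> b) = s a \<^bold>\<or> s b) \<and>
     (\<forall>a. s (\<^bold>\<not> a) = \<^bold>\<not> (s a))"

type_synonym rule = "fm list \<times> fm"

definition rule_instance :: "rule set \<Rightarrow> fm set \<Rightarrow> fm \<Rightarrow> bool" where
  "rule_instance R \<Delta> \<psi> \<longleftrightarrow>
     (\<exists>(\<gamma>s, \<chi>) \<in> R. \<exists>s. substitution s \<and> \<Delta> = s ` set \<gamma>s \<and> \<psi> = s \<chi>)"

definition derivation :: "rule set \<Rightarrow> fm set \<Rightarrow> fm list \<Rightarrow> bool" where
  "derivation R \<Gamma> xs \<longleftrightarrow>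
     (\<forall>i < length xs. xs ! i \<in> \<Gamma> \<or>
        (\<exists>\<Delta>. rule_instance R \<Delta> (xs ! i) \<and> \<Delta> \<subseteq> set (take i xs)))"

definition derives :: "rule set \<Rightarrow> fm set \<Rightarrow> fm \<Rightarrow> bool" where
  "derives R \<Gamma> \<phi> \<longleftrightarrow> (\<exists>xs. xs \<noteq> [] \<and> last xs = \<phi> \<and> derivation R \<Gamma> xs)"

definition R'_PWK :: "rule set" where
  "R'_PWK = (let p = Var 0; q = Var 1; r = Var 2 in
    {([], p \<^bold>\<or> \<^bold>\<not> p),
     ([p \<^bold>\<or> r], \<^bold>\<not> \<^bold>\<not> p \<^bold>\<or> r),
     ([\<^bold>\<not> \<^bold>\<not> p \<^bold>\<or> r], p \<^bold>\<or> r),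
     ([p \<^bold>\<or> r, q \<^bold>\<or> r], (p \<^bold>\<and> q) \<^bold>\<or> r),
     ([(p \<^bold>\<and> q) \<^bold>\<or> r], (p \<^bold>\<or> q) \<^bold>\<or> r),
     ([(p \<^bold>\<and> q) \<^bold>\<or> r], (p \<^bold>\<or> \<^bold>\<not> q) \<^bold>\<or> r),
     ([(p \<^bold>\<and> q) \<^bold>\<or> r], (\<^bold>\<not> p \<^bold>\<or> q) \<^bold>\<or> r),
     ([\<^bold>\<not> (p \<^bold>\<and> q) \<^bold>\<or> r], (\<^bold>\<not> p \<^bold>\<or> \<^bold>\<not> q) \<^bold>\<or> r),
     ([p \<^bold>\<or> r, \<^bold>\<not> p \<^bold>\<or> r], (p \<^bold>\<and> q) \<^bold>\<or> r),
     ([\<^bold>\<not> p \<^bold>\<or> r], \<^bold>\<not> (p \<^bold>\<and> q) \<^bold>\<or> r),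
     ([q \<^bold>\<or> r, \<^bold>\<not> q \<^bold>\<or> r], (p \<^bold>\<and> q) \<^bold>\<or> r),
     ([\<^bold>\<not> q \<^bold>\<or> r], \<^bold>\<not> (p \<^bold>\<and> q) \<^bold>\<or> r),
     ([p \<^bold>\<or> r], (p \<^bold>\<or> q) \<^bold>\<or> r),
     ([q \<^bold>\<or> r], (p \<^bold>\<or> q) \<^bold>\<or> r),
     ([\<^bold>\<not> (p \<^bold>\<or> q) \<^bold>\<or> r], (p \<^bold>\<or> \<^bold>\<not> q) \<^bold>\<or> r),
     ([\<^bold>\<not> (p \<^bold>\<or> q) \<^bold>\<or> r], (\<^bold>\<not> p \<^bold>\<or> q) \<^bold>\<or> r),
     ([\<^bold>\<not> (p \<^bold>\<or> q) \<^bold>\<or> r], (\<^bold>\<not> p \<^bold>\<or> \<^bold>\<not> q) \<^bold>\<or> r),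
     ([p \<^bold>\<or> r, \<^bold>\<not> p \<^bold>\<or> r], \<^bold>\<not> (p \<^bold>\<or> q) \<^bold>\<or> r),
     ([q \<^bold>\<or> r, \<^bold>\<not> q \<^bold>\<or> r], \<^bold>\<not> (p \<^bold>\<or> q) \<^bold>\<or> r),
     ([p \<^bold>\<or> p], p),
     ([p], p \<^bold>\<or> q),
     ([p \<^bold>\<or> q], q \<^bold>\<or> p),
     ([p \<^bold>\<or> (q \<^bold>\<or> r)], (p \<^bold>\<or> q) \<^bold>\<or> r)})"

end

theory Submission
  imports Defs
begin

text \<open>Soundness holds rule by rule. For completeness, every rule remains derivable inside a
  disjunctive context, which yields proof by cases from a disjunction. Hence a theory that is
  maximal among those not proving \<open>\<phi>\<close> is prime, and it induces a countermodel: a formula gets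
  the value \<open>U\<close> if the theory contains both it and its negation, \<open>T\<close> if it contains only the
  formula, and \<open>F\<close> otherwise.\<close>

section \<open>Hilbert systems\<close>

lemma finite_rule_instance: "rule_instance R \<Delta> \<psi> \<Longrightarrow> finite \<Delta>"
  unfolding rule_instance_def by auto

lemma derivation_Nil: "derivation R \<Gamma> []"
  by (simp add: derivation_def)

lemma derivation_snoc_iff:
  "derivation R \<Gamma> (xs @ [x]) \<longleftrightarrow>
     derivation R \<Gamma> xs \<and> (x \<in> \<Gamma> \<or> (\<exists>\<Delta>. rule_instance R \<Delta> x \<and> \<Delta> \<subseteq> set xs))"
  by (auto simp: derivation_def nth_append less_Suc_eq)

lemma derivation_append:
  assumes "derivation R \<Gamma> xs" "derivation R \<Gamma> ys"
  shows "derivation R \<Gamma> (xs @ ys)"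
  using assms(2)
proof (induction ys rule: rev_induct)
  case Nil
  then show ?case using assms(1) by simp
next
  case (snoc y ys)
  then have "derivation R \<Gamma> (xs @ ys)"
    and "y \<in> \<Gamma> \<or> (\<exists>\<Delta>. rule_instance R \<Delta> y \<and> \<Delta> \<subseteq> set (xs @ ys))"
    by (auto simp: derivation_snoc_iff)
  then show ?case using derivation_snoc_iff[of R \<Gamma> "xs @ ys" y] by simp
qed

lemma finite_derives_imp_derivation:
  assumes "finite \<Delta>" "\<And>\<delta>. \<delta> \<in> \<Delta> \<Longrightarrow> derives R \<Gamma> \<delta>"
  shows "\<exists>xs. derivation R \<Gamma> xs \<and> \<Delta> \<subseteq> set xs"
  using assms
proof (induction \<Delta> rule: finite_induct)
  case empty
  show ?case using derivation_Nil by blast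
next
  case (insert \<delta> \<Delta>)
  then obtain xs where xs: "derivation R \<Gamma> xs" "\<Delta> \<subseteq> set xs" by auto
  obtain ys where "ys \<noteq> []" "last ys = \<delta>" "derivation R \<Gamma> ys"
    using insert.prems by (auto simp: derives_def)
  with xs have "derivation R \<Gamma> (ys @ xs)" "insert \<delta> \<Delta> \<subseteq> set (ys @ xs)"
    by (auto intro: derivation_append)
  then show ?case by blast
qed

lemma derives_premise:
  assumes "a \<in> \<Gamma>"
  shows "derives R \<Gamma> a"
proof -
  have "derivation R \<Gamma> [a]"
    using assms by (simp add: derivation_def)
  then show ?thesis unfolding derives_def by (intro exI[of _ "[a]"]) simp
qed

lemma derives_rule_instance:
  assumes "rule_instance R \<Delta> \<psi>" "\<And>\<delta>. \<delta> \<in> \<Delta> \<Longrightarrow> derives R \<Gamma> \<delta>"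
  shows "derives R \<Gamma> \<psi>"
proof -
  obtain xs where "derivation R \<Gamma> xs" "\<Delta> \<subseteq> set xs"
    using finite_derives_imp_derivation[OF finite_rule_instance] assms by blast
  with assms(1) have "derivation R \<Gamma> (xs @ [\<psi>])"
    by (auto simp: derivation_snoc_iff)
  then show ?thesis unfolding derives_def by (intro exI[of _ "xs @ [\<psi>]"]) simp
qed

lemma derives_induct [consumes 1, case_names premise rule]:
  assumes "derives R \<Gamma> \<phi>"
    and premise: "\<And>a. a \<in> \<Gamma> \<Longrightarrow> P a"
    and rule: "\<And>\<Delta> \<psi>. rule_instance R \<Delta> \<psi> \<Longrightarrow> (\<And>\<delta>. \<delta> \<in> \<Delta> \<Longrightarrow> P \<delta>) \<Longrightarrow> P \<psi>"
  shows "P \<phi>"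
proof -
  obtain xs where xs: "xs \<noteq> []" "last xs = \<phi>" "derivation R \<Gamma> xs"
    using assms(1) unfolding derives_def by blast
  from xs(3) have "\<forall>x \<in> set xs. P x"
  proof (induction xs rule: rev_induct)
    case (snoc x xs)
    then have "\<forall>y \<in> set xs. P y"
      and "x \<in> \<Gamma> \<or> (\<exists>\<Delta>. rule_instance R \<Delta> x \<and> \<Delta> \<subseteq> set xs)"
      by (simp_all add: derivation_snoc_iff)
    then have "P x" by (blast intro: premise rule)
    with \<open>\<forall>y \<in> set xs. P y\<close> show ?case by simp
  qed simp
  with xs(1,2) show ?thesis by auto
qed

lemma derives_cut:
  assumes "derives R \<Delta> \<phi>" "\<And>a. a \<in> \<Delta> \<Longrightarrow> derives R \<Gamma> a"
  shows "derives R \<Gamma> \<phi>"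
  using assms(1)
proof (induction rule: derives_induct)
  case (premise a)
  then show ?case by (rule assms(2))
next
  case (rule \<Delta> \<psi>)
  then show ?case by (rule derives_rule_instance)
qed

lemma derives_mono: "derives R \<Delta> \<phi> \<Longrightarrow> \<Delta> \<subseteq> \<Gamma> \<Longrightarrow> derives R \<Gamma> \<phi>"
  by (blast intro: derives_cut derives_premise)

lemma derives_compact:
  assumes "derives R \<Gamma> \<phi>"
  obtains \<Delta> where "finite \<Delta>" "\<Delta> \<subseteq> \<Gamma>" "derives R \<Delta> \<phi>"
proof -
  obtain xs where xs: "xs \<noteq> []" "last xs = \<phi>" "derivation R \<Gamma> xs"
    using assms unfolding derives_def by blast
  then have "derivation R (\<Gamma> \<inter> set xs) xs" by (auto simp: derivation_def)
  with xs(1,2) have "derives R (\<Gamma> \<inter> set xs) \<phi>" unfolding derives_def by blast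
  then show thesis by (rule that[rotated 2]) auto
qed

section \<open>Relatively maximal theories\<close>

definition relatively_maximal :: "rule set \<Rightarrow> fm \<Rightarrow> fm set \<Rightarrow> bool" where
  "relatively_maximal R \<phi> M \<longleftrightarrow>
     \<not> derives R M \<phi> \<and> (\<forall>a. a \<notin> M \<longrightarrow> derives R (insert a M) \<phi>)"

lemma not_derives_Union_chain:
  assumes "C \<noteq> {}" "subset.chain {M. \<not> derives R M \<phi>} C"
  shows "\<not> derives R (\<Union>C) \<phi>"
proof
  assume "derives R (\<Union>C) \<phi>"
  then obtain \<Delta> where "finite \<Delta>" "\<Delta> \<subseteq> \<Union>C" and \<Delta>: "derives R \<Delta> \<phi>"
    by (rule derives_compact)
  then obtain M where "M \<in> C" "\<Delta> \<subseteq> M"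
    using finite_subset_Union_chain assms by metis
  with \<Delta> have "derives R M \<phi>" by (blast intro: derives_mono)
  with \<open>M \<in> C\<close> show False using assms(2) unfolding subset_chain_def by blast
qed

lemma lindenbaum:
  assumes "\<not> derives R \<Gamma> \<phi>"
  obtains M where "\<Gamma> \<subseteq> M" "relatively_maximal R \<phi> M"
proof -
  let ?S = "{M. \<Gamma> \<subseteq> M \<and> \<not> derives R M \<phi>}"
  have "\<Union>C \<in> ?S" if "C \<noteq> {}" "subset.chain ?S C" for C
  proof -
    have "subset.chain {M. \<not> derives R M \<phi>} C" "\<Gamma> \<subseteq> \<Union>C"
      using that unfolding subset_chain_def by blast+
    with that(1) not_derives_Union_chain show ?thesis by blast
  qed
  moreover have "?S \<noteq> {}" using assms by blast
  ultimately obtain M where M: "M \<in> ?S" and maximal: "\<forall>X \<in> ?S. M \<subseteq> X \<longrightarrow> X = M"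
    using subset_Zorn_nonempty[of ?S] by blast
  have "derives R (insert a M) \<phi>" if "a \<notin> M" for a
  proof (rule ccontr)
    assume "\<not> derives R (insert a M) \<phi>"
    with M have "insert a M \<in> ?S" by blast
    with maximal have "insert a M = M" by blast
    with that show False by blast
  qed
  with M that show thesis unfolding relatively_maximal_def by blast
qed

lemma relatively_maximal_derives_iff:
  assumes "relatively_maximal R \<phi> M"
  shows "derives R M a \<longleftrightarrow> a \<in> M"
proof
  assume "derives R M a"
  then have "derives R M \<phi>" if "derives R (insert a M) \<phi>"
    using that by (blast intro: derives_cut derives_premise)
  then show "a \<in> M" using assms unfolding relatively_maximal_def by blast
qed (rule derives_premise)

lemma relatively_maximal_not_mem: "relatively_maximal R \<phi> M \<Longrightarrow> \<phi> \<notin> M"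
  unfolding relatively_maximal_def by (blast intro: derives_premise)

section \<open>Disjunction in Hilbert systems\<close>

locale disjunction_calculus =
  fixes R :: "rule set"
  assumes contraction: "derives R \<Gamma> (a \<^bold>\<or> a) \<Longrightarrow> derives R \<Gamma> a"
    and weakening: "derives R \<Gamma> a \<Longrightarrow> derives R \<Gamma> (a \<^bold>\<or> b)"
    and commute: "derives R \<Gamma> (a \<^bold>\<or> b) \<Longrightarrow> derives R \<Gamma> (b \<^bold>\<or> a)"
    and assoc: "derives R \<Gamma> (a \<^bold>\<or> (b \<^bold>\<or> c)) \<Longrightarrow> derives R \<Gamma> ((a \<^bold>\<or> b) \<^bold>\<or> c)"
    and disj_intro_left: "derives R \<Gamma> (a \<^bold>\<or> c) \<Longrightarrow> derives R \<Gamma> ((a \<^bold>\<or> b) \<^bold>\<or> c)"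
    and disj_intro_right: "derives R \<Gamma> (b \<^bold>\<or> c) \<Longrightarrow> derives R \<Gamma> ((a \<^bold>\<or> b) \<^bold>\<or> c)"
begin

lemma assoc_reverse:
  assumes "derives R \<Gamma> ((a \<^bold>\<or> b) \<^bold>\<or> c)"
  shows "derives R \<Gamma> (a \<^bold>\<or> (b \<^bold>\<or> c))"
proof -
  from assms have "derives R \<Gamma> (c \<^bold>\<or> (a \<^bold>\<or> b))" by (rule commute)
  then have "derives R \<Gamma> ((c \<^bold>\<or> a) \<^bold>\<or> b)" by (rule assoc)
  then have "derives R \<Gamma> (b \<^bold>\<or> (c \<^bold>\<or> a))" by (rule commute)
  then have "derives R \<Gamma> ((b \<^bold>\<or> c) \<^bold>\<or> a)" by (rule assoc)
  then show ?thesis by (rule commute)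
qed

lemma contraction_context:
  assumes "derives R \<Gamma> ((a \<^bold>\<or> a) \<^bold>\<or> d)"
  shows "derives R \<Gamma> (a \<^bold>\<or> d)"
proof -
  from assms have "derives R \<Gamma> (a \<^bold>\<or> (a \<^bold>\<or> d))" by (rule assoc_reverse)
  then have "derives R \<Gamma> ((a \<^bold>\<or> d) \<^bold>\<or> (a \<^bold>\<or> d))" by (rule disj_intro_left)
  then show ?thesis by (rule contraction)
qed

text \<open>Commutativity and associativity alone only move the outermost disjunction to another edge of a
  planar ternary tree, so they cannot be applied inside a context. The way out is to weaken to two
  copies of the desired conclusion and contract.\<close>

lemma commute_context:
  assumes "derives R \<Gamma> ((a \<^bold>\<or> b) \<^bold>\<or> d)"
  shows "derives R \<Gamma> ((b \<^bold>\<or> a) \<^bold>\<or> d)"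
proof -
  let ?D = "(b \<^bold>\<or> a) \<^bold>\<or> d"
  from assms have "derives R \<Gamma> (a \<^bold>\<or> (b \<^bold>\<or> d))" by (rule assoc_reverse)
  then have "derives R \<Gamma> ((b \<^bold>\<or> d) \<^bold>\<or> a)" by (rule commute)
  then have "derives R \<Gamma> (b \<^bold>\<or> (d \<^bold>\<or> a))" by (rule assoc_reverse)
  then have "derives R \<Gamma> ((b \<^bold>\<or> a) \<^bold>\<or> (d \<^bold>\<or> a))" by (rule disj_intro_left)
  then have "derives R \<Gamma> (?D \<^bold>\<or> a)" by (rule assoc)
  then have "derives R \<Gamma> (a \<^bold>\<or> ?D)" by (rule commute)
  then have "derives R \<Gamma> ((b \<^bold>\<or> a) \<^bold>\<or> ?D)" by (rule disj_intro_right)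
  then have "derives R \<Gamma> (?D \<^bold>\<or> ?D)" by (rule disj_intro_left)
  then show ?thesis by (rule contraction)
qed

lemma assoc_context:
  assumes "derives R \<Gamma> ((a \<^bold>\<or> (b \<^bold>\<or> c)) \<^bold>\<or> d)"
  shows "derives R \<Gamma> (((a \<^bold>\<or> b) \<^bold>\<or> c) \<^bold>\<or> d)"
proof -
  let ?D = "((a \<^bold>\<or> b) \<^bold>\<or> c) \<^bold>\<or> d"
  from assms have "derives R \<Gamma> (a \<^bold>\<or> ((b \<^bold>\<or> c) \<^bold>\<or> d))" by (rule assoc_reverse)
  then have "derives R \<Gamma> (((b \<^bold>\<or> c) \<^bold>\<or> d) \<^bold>\<or> a)" by (rule commute)
  then have "derives R \<Gamma> (b \<^bold>\<or> (c \<^bold>\<or> (d \<^bold>\<or> a)))" by (intro assoc_reverse)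
  then have "derives R \<Gamma> ((a \<^bold>\<or> b) \<^bold>\<or> (c \<^bold>\<or> (d \<^bold>\<or> a)))" by (rule disj_intro_right)
  then have "derives R \<Gamma> (?D \<^bold>\<or> a)" by (rule assoc[OF assoc])
  then have "derives R \<Gamma> (a \<^bold>\<or> ?D)" by (rule commute)
  then have "derives R \<Gamma> (?D \<^bold>\<or> ?D)" by (intro disj_intro_left)
  then show ?thesis by (rule contraction)
qed

end

locale disjunctive_calculus = disjunction_calculus +
  assumes rule_instance_context:
    "rule_instance R \<Delta> \<psi> \<Longrightarrow> (\<And>\<delta>. \<delta> \<in> \<Delta> \<Longrightarrow> derives R \<Gamma> (\<delta> \<^bold>\<or> d)) \<Longrightarrow> derives R \<Gamma> (\<psi> \<^bold>\<or> d)"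
begin

lemma derives_context:
  assumes "derives R \<Delta> \<phi>" "\<And>a. a \<in> \<Delta> \<Longrightarrow> derives R \<Gamma> (a \<^bold>\<or> d)"
  shows "derives R \<Gamma> (\<phi> \<^bold>\<or> d)"
  using assms(1)
proof (induction rule: derives_induct)
  case (premise a)
  then show ?case by (rule assms(2))
next
  case (rule \<Delta> \<psi>)
  then show ?case by (rule rule_instance_context)
qed

lemma derives_disj_elim:
  assumes "derives R \<Gamma> (a \<^bold>\<or> b)" "derives R (insert a \<Gamma>) \<phi>" "derives R (insert b \<Gamma>) \<phi>"
  shows "derives R \<Gamma> \<phi>"
proof -
  have "derives R \<Gamma> (\<phi> \<^bold>\<or> b)"
    by (intro derives_context[OF assms(2)]) (use assms(1) in \<open>auto intro: weakening derives_premise\<close>)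
  then have "derives R \<Gamma> (b \<^bold>\<or> \<phi>)" by (rule commute)
  then have "derives R \<Gamma> (\<phi> \<^bold>\<or> \<phi>)"
    by (intro derives_context[OF assms(3)]) (auto intro: weakening derives_premise)
  then show ?thesis by (rule contraction)
qed

lemma relatively_maximal_prime:
  assumes "relatively_maximal R \<phi> M"
  shows "a \<^bold>\<or> b \<in> M \<longleftrightarrow> a \<in> M \<or> b \<in> M"
proof
  assume "a \<^bold>\<or> b \<in> M"
  then show "a \<in> M \<or> b \<in> M"
    using assms derives_disj_elim[OF derives_premise] unfolding relatively_maximal_def by blast
next
  assume "a \<in> M \<or> b \<in> M"
  then have "derives R M (a \<^bold>\<or> b)" by (blast intro: weakening commute derives_premise)
  then show "a \<^bold>\<or> b \<in> M" using relatively_maximal_derives_iff[OF assms] by blast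
qed

end

section \<open>Paraconsistent weak Kleene semantics\<close>

lemma pwk_iff:
  "\<Gamma> \<turnstile>\<^sub>P\<^sub>W\<^sub>K \<phi> \<longleftrightarrow> (\<forall>v. valuation v \<longrightarrow> (\<forall>a \<in> \<Gamma>. v a \<noteq> F) \<longrightarrow> v \<phi> \<noteq> F)"
proof -
  have "x \<in> {U, T} \<longleftrightarrow> x \<noteq> F" for x by (cases x) auto
  then show ?thesis unfolding pwk_def image_subset_iff by blast
qed

lemma valuation_comp_substitution:
  "valuation v \<Longrightarrow> substitution s \<Longrightarrow> valuation (v \<circ> s)"
  by (simp add: valuation_def substitution_def)

lemma pwk_substitution:
  assumes "\<Gamma> \<turnstile>\<^sub>P\<^sub>W\<^sub>K \<phi>" "substitution s"
  shows "s ` \<Gamma> \<turnstile>\<^sub>P\<^sub>W\<^sub>K s \<phi>"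
  unfolding pwk_iff
proof (intro allI impI)
  fix v assume "valuation v" "\<forall>a \<in> s ` \<Gamma>. v a \<noteq> F"
  then have "valuation (v \<circ> s)" "\<forall>a \<in> \<Gamma>. (v \<circ> s) a \<noteq> F"
    using assms(2) by (simp_all add: valuation_comp_substitution)
  with assms(1) have "(v \<circ> s) \<phi> \<noteq> F" unfolding pwk_iff by blast
  then show "v (s \<phi>) \<noteq> F" by simp
qed

lemma derives_sound:
  assumes schemas: "\<forall>(\<gamma>s, \<chi>) \<in> R. set \<gamma>s \<turnstile>\<^sub>P\<^sub>W\<^sub>K \<chi>"
    and "derives R \<Gamma> \<phi>"
  shows "\<Gamma> \<turnstile>\<^sub>P\<^sub>W\<^sub>K \<phi>"
  using assms(2)
proof (induction rule: derives_induct)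
  case (premise a)
  then show ?case unfolding pwk_iff by blast
next
  case (rule \<Delta> \<psi>)
  then have "\<Delta> \<turnstile>\<^sub>P\<^sub>W\<^sub>K \<psi>"
    using schemas unfolding rule_instance_def by (auto intro: pwk_substitution)
  with rule.IH show ?case unfolding pwk_iff by blast
qed

lemma conj_tv_eq_F_iff: "conj_tv x y = F \<longleftrightarrow> x = F \<and> y \<in> {F, T} \<or> x = T \<and> y = F"
  and conj_tv_eq_T_iff: "conj_tv x y = T \<longleftrightarrow> x = T \<and> y = T"
  and disj_tv_eq_F_iff: "disj_tv x y = F \<longleftrightarrow> x = F \<and> y = F"
  and disj_tv_eq_T_iff: "disj_tv x y = T \<longleftrightarrow> x = T \<and> y \<in> {F, T} \<or> x = F \<and> y = T"
  and neg_tv_eq_F_iff: "neg_tv x = F \<longleftrightarrow> x = T"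
  and neg_tv_eq_T_iff: "neg_tv x = T \<longleftrightarrow> x = F"
  by (cases x; cases y; simp add: conj_tv_def disj_tv_def neg_tv_def of_bool_tv_def)+

lemmas tv_eq_iffs = conj_tv_eq_F_iff conj_tv_eq_T_iff disj_tv_eq_F_iff disj_tv_eq_T_iff
  neg_tv_eq_F_iff neg_tv_eq_T_iff

text \<open>The conditions are read off the truth tables, with \<open>M\<close> in the role of the set of formulas that
  take a value in \<open>{U, T}\<close>.\<close>

locale pwk_saturated =
  fixes M :: "fm set"
  assumes mem_or_neg_mem: "a \<in> M \<or> \<^bold>\<not> a \<in> M"
    and neg_neg_mem_iff: "\<^bold>\<not> \<^bold>\<not> a \<in> M \<longleftrightarrow> a \<in> M"
    and conj_mem_iff: "a \<^bold>\<and> b \<in> M \<longleftrightarrow>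
      a \<in> M \<and> b \<in> M \<or> a \<in> M \<and> \<^bold>\<not> a \<in> M \<or> b \<in> M \<and> \<^bold>\<not> b \<in> M"
    and neg_conj_mem_iff: "\<^bold>\<not> (a \<^bold>\<and> b) \<in> M \<longleftrightarrow> \<^bold>\<not> a \<in> M \<or> \<^bold>\<not> b \<in> M"
    and disj_mem_iff: "a \<^bold>\<or> b \<in> M \<longleftrightarrow> a \<in> M \<or> b \<in> M"
    and neg_disj_mem_iff: "\<^bold>\<not> (a \<^bold>\<or> b) \<in> M \<longleftrightarrow>
      \<^bold>\<not> a \<in> M \<and> \<^bold>\<not> b \<in> M \<or> a \<in> M \<and> \<^bold>\<not> a \<in> M \<or> b \<in> M \<and> \<^bold>\<not> b \<in> M"
begin

definition canonical_valuation :: "fm \<Rightarrow> tv" where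
  "canonical_valuation a = (if a \<notin> M then F else if \<^bold>\<not> a \<in> M then U else T)"

lemma canonical_valuation_eq_F_iff: "canonical_valuation a = F \<longleftrightarrow> a \<notin> M"
  by (simp add: canonical_valuation_def)

lemma valuation_canonical_valuation: "valuation canonical_valuation"
  unfolding valuation_def
proof (intro conjI allI)
  fix a b
  show "canonical_valuation (\<^bold>\<not> a) = neg_tv (canonical_valuation a)"
    using mem_or_neg_mem[of a] neg_neg_mem_iff[of a]
    by (auto simp: canonical_valuation_def neg_tv_def of_bool_tv_def)
  show "canonical_valuation (a \<^bold>\<and> b) = conj_tv (canonical_valuation a) (canonical_valuation b)"
    using mem_or_neg_mem[of a] mem_or_neg_mem[of b]
    by (auto simp: canonical_valuation_def conj_tv_def of_bool_tv_def conj_mem_iff neg_conj_mem_iff)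
  show "canonical_valuation (a \<^bold>\<or> b) = disj_tv (canonical_valuation a) (canonical_valuation b)"
    using mem_or_neg_mem[of a] mem_or_neg_mem[of b]
    by (auto simp: canonical_valuation_def disj_tv_def of_bool_tv_def disj_mem_iff neg_disj_mem_iff)
qed

lemma not_pwk:
  assumes "\<Gamma> \<subseteq> M" "\<phi> \<notin> M"
  shows "\<not> \<Gamma> \<turnstile>\<^sub>P\<^sub>W\<^sub>K \<phi>"
  using assms valuation_canonical_valuation canonical_valuation_eq_F_iff
  unfolding pwk_iff by blast

end

section \<open>The system \<open>R'_PWK\<close>\<close>

abbreviation derives_PWK :: "fm set \<Rightarrow> fm \<Rightarrow> bool"  (infix \<open>\<turnstile>\<^sub>R\<close> 50) where
  "\<Gamma> \<turnstile>\<^sub>R a \<equiv> derives R'_PWK \<Gamma> a"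

text \<open>Unlike \<open>R'_PWK_def\<close>, this expands \<open>R'_PWK\<close> only as the range of a quantifier and leaves
  \<open>derives R'_PWK\<close> intact.\<close>

lemmas Ball_R'_PWK = arg_cong[OF R'_PWK_def, of "\<lambda>R. Ball R Q" for Q, unfolded Let_def ball_simps]

lemma R'_PWK_schema_sound: "\<forall>(\<gamma>s, \<chi>) \<in> R'_PWK. set \<gamma>s \<turnstile>\<^sub>P\<^sub>W\<^sub>K \<chi>"
  by (auto simp: Ball_R'_PWK pwk_iff valuation_def tv_eq_iffs)

primrec subst :: "(nat \<Rightarrow> fm) \<Rightarrow> fm \<Rightarrow> fm" where
  "subst \<sigma> (Var n) = \<sigma> n"
| "subst \<sigma> (a \<^bold>\<and> b) = subst \<sigma> a \<^bold>\<and> subst \<sigma> b"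
| "subst \<sigma> (a \<^bold>\<or> b) = subst \<sigma> a \<^bold>\<or> subst \<sigma> b"
| "subst \<sigma> (\<^bold>\<not> a) = \<^bold>\<not> subst \<sigma> a"

lemma rule_instance_subst:
  assumes "(\<gamma>s, \<chi>) \<in> R"
  shows "rule_instance R (subst \<sigma> ` set \<gamma>s) (subst \<sigma> \<chi>)"
proof -
  have "substitution (subst \<sigma>)" by (simp add: substitution_def)
  with assms show ?thesis unfolding rule_instance_def by blast
qed

lemma derives_subst:
  "\<forall>(\<gamma>s, \<chi>) \<in> R. (\<forall>\<gamma> \<in> set \<gamma>s. derives R \<Gamma> (subst \<sigma> \<gamma>)) \<longrightarrow> derives R \<Gamma> (subst \<sigma> \<chi>)"
  by (auto intro: derives_rule_instance[OF rule_instance_subst])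

lemma derives_excluded_middle: "\<Gamma> \<turnstile>\<^sub>R a \<^bold>\<or> \<^bold>\<not> a"
  and neg_neg_intro: "\<Gamma> \<turnstile>\<^sub>R a \<^bold>\<or> c \<Longrightarrow> \<Gamma> \<turnstile>\<^sub>R \<^bold>\<not> \<^bold>\<not> a \<^bold>\<or> c"
  and neg_neg_elim: "\<Gamma> \<turnstile>\<^sub>R \<^bold>\<not> \<^bold>\<not> a \<^bold>\<or> c \<Longrightarrow> \<Gamma> \<turnstile>\<^sub>R a \<^bold>\<or> c"
  and conj_intro: "\<Gamma> \<turnstile>\<^sub>R a \<^bold>\<or> c \<Longrightarrow> \<Gamma> \<turnstile>\<^sub>R b \<^bold>\<or> c \<Longrightarrow> \<Gamma> \<turnstile>\<^sub>R (a \<^bold>\<and> b) \<^bold>\<or> c"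
  and conj_elim: "\<Gamma> \<turnstile>\<^sub>R (a \<^bold>\<and> b) \<^bold>\<or> c \<Longrightarrow> \<Gamma> \<turnstile>\<^sub>R (a \<^bold>\<or> b) \<^bold>\<or> c"
  and conj_elim_right_neg: "\<Gamma> \<turnstile>\<^sub>R (a \<^bold>\<and> b) \<^bold>\<or> c \<Longrightarrow> \<Gamma> \<turnstile>\<^sub>R (a \<^bold>\<or> \<^bold>\<not> b) \<^bold>\<or> c"
  and conj_elim_left_neg: "\<Gamma> \<turnstile>\<^sub>R (a \<^bold>\<and> b) \<^bold>\<or> c \<Longrightarrow> \<Gamma> \<turnstile>\<^sub>R (\<^bold>\<not> a \<^bold>\<or> b) \<^bold>\<or> c"
  and conj_intro_left_glut: "\<Gamma> \<turnstile>\<^sub>R a \<^bold>\<or> c \<Longrightarrow> \<Gamma> \<turnstile>\<^sub>R \<^bold>\<not> a \<^bold>\<or> c \<Longrightarrow> \<Gamma> \<turnstile>\<^sub>R (a \<^bold>\<and> b) \<^bold>\<or> c"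
  and conj_intro_right_glut: "\<Gamma> \<turnstile>\<^sub>R b \<^bold>\<or> c \<Longrightarrow> \<Gamma> \<turnstile>\<^sub>R \<^bold>\<not> b \<^bold>\<or> c \<Longrightarrow> \<Gamma> \<turnstile>\<^sub>R (a \<^bold>\<and> b) \<^bold>\<or> c"
  and neg_conj_elim: "\<Gamma> \<turnstile>\<^sub>R \<^bold>\<not> (a \<^bold>\<and> b) \<^bold>\<or> c \<Longrightarrow> \<Gamma> \<turnstile>\<^sub>R (\<^bold>\<not> a \<^bold>\<or> \<^bold>\<not> b) \<^bold>\<or> c"
  and neg_conj_intro_left: "\<Gamma> \<turnstile>\<^sub>R \<^bold>\<not> a \<^bold>\<or> c \<Longrightarrow> \<Gamma> \<turnstile>\<^sub>R \<^bold>\<not> (a \<^bold>\<and> b) \<^bold>\<or> c"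
  and neg_conj_intro_right: "\<Gamma> \<turnstile>\<^sub>R \<^bold>\<not> b \<^bold>\<or> c \<Longrightarrow> \<Gamma> \<turnstile>\<^sub>R \<^bold>\<not> (a \<^bold>\<and> b) \<^bold>\<or> c"
  and neg_disj_elim: "\<Gamma> \<turnstile>\<^sub>R \<^bold>\<not> (a \<^bold>\<or> b) \<^bold>\<or> c \<Longrightarrow> \<Gamma> \<turnstile>\<^sub>R (\<^bold>\<not> a \<^bold>\<or> \<^bold>\<not> b) \<^bold>\<or> c"
  and neg_disj_elim_right_neg: "\<Gamma> \<turnstile>\<^sub>R \<^bold>\<not> (a \<^bold>\<or> b) \<^bold>\<or> c \<Longrightarrow> \<Gamma> \<turnstile>\<^sub>R (a \<^bold>\<or> \<^bold>\<not> b) \<^bold>\<or> c"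
  and neg_disj_elim_left_neg: "\<Gamma> \<turnstile>\<^sub>R \<^bold>\<not> (a \<^bold>\<or> b) \<^bold>\<or> c \<Longrightarrow> \<Gamma> \<turnstile>\<^sub>R (\<^bold>\<not> a \<^bold>\<or> b) \<^bold>\<or> c"
  and neg_disj_intro_left_glut: "\<Gamma> \<turnstile>\<^sub>R a \<^bold>\<or> c \<Longrightarrow> \<Gamma> \<turnstile>\<^sub>R \<^bold>\<not> a \<^bold>\<or> c \<Longrightarrow> \<Gamma> \<turnstile>\<^sub>R \<^bold>\<not> (a \<^bold>\<or> b) \<^bold>\<or> c"
  and neg_disj_intro_right_glut: "\<Gamma> \<turnstile>\<^sub>R b \<^bold>\<or> c \<Longrightarrow> \<Gamma> \<turnstile>\<^sub>R \<^bold>\<not> b \<^bold>\<or> c \<Longrightarrow> \<Gamma> \<turnstile>\<^sub>R \<^bold>\<not> (a \<^bold>\<or> b) \<^bold>\<or> c"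
  and disj_intro_left: "\<Gamma> \<turnstile>\<^sub>R a \<^bold>\<or> c \<Longrightarrow> \<Gamma> \<turnstile>\<^sub>R (a \<^bold>\<or> b) \<^bold>\<or> c"
  and disj_intro_right: "\<Gamma> \<turnstile>\<^sub>R b \<^bold>\<or> c \<Longrightarrow> \<Gamma> \<turnstile>\<^sub>R (a \<^bold>\<or> b) \<^bold>\<or> c"
  and contraction: "\<Gamma> \<turnstile>\<^sub>R a \<^bold>\<or> a \<Longrightarrow> \<Gamma> \<turnstile>\<^sub>R a"
  and weakening: "\<Gamma> \<turnstile>\<^sub>R a \<Longrightarrow> \<Gamma> \<turnstile>\<^sub>R a \<^bold>\<or> b"
  and commute: "\<Gamma> \<turnstile>\<^sub>R a \<^bold>\<or> b \<Longrightarrow> \<Gamma> \<turnstile>\<^sub>R b \<^bold>\<or> a"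
  and assoc: "\<Gamma> \<turnstile>\<^sub>R a \<^bold>\<or> (b \<^bold>\<or> c) \<Longrightarrow> \<Gamma> \<turnstile>\<^sub>R (a \<^bold>\<or> b) \<^bold>\<or> c"
  using derives_subst[of R'_PWK \<Gamma> "(\<lambda>_. c)(0 := a, 1 := b)"]
  by (simp_all add: Ball_R'_PWK)

interpretation pwk: disjunction_calculus R'_PWK
  by unfold_locales (fact contraction weakening commute assoc disj_intro_left disj_intro_right)+

text \<open>A rule with a side formula \<open>c\<close> survives in the context \<open>d\<close> because \<open>c \<^bold>\<or> d\<close> can take the role
  of its side formula.\<close>

lemmas one_premise_rules = neg_neg_intro neg_neg_elim conj_elim conj_elim_right_neg
  conj_elim_left_neg neg_conj_elim neg_conj_intro_left neg_conj_intro_right disj_intro_left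
  disj_intro_right neg_disj_elim neg_disj_elim_right_neg neg_disj_elim_left_neg

lemmas two_premise_rules = conj_intro conj_intro_left_glut conj_intro_right_glut
  neg_disj_intro_left_glut neg_disj_intro_right_glut

lemmas side_formula_rules_context =
  one_premise_rules[OF pwk.assoc_reverse, THEN assoc]
  two_premise_rules[OF pwk.assoc_reverse pwk.assoc_reverse, THEN assoc]

lemma R'_PWK_rule_instance_context:
  assumes "rule_instance R'_PWK \<Delta> \<psi>" "\<And>\<delta>. \<delta> \<in> \<Delta> \<Longrightarrow> \<Gamma> \<turnstile>\<^sub>R \<delta> \<^bold>\<or> d"
  shows "\<Gamma> \<turnstile>\<^sub>R \<psi> \<^bold>\<or> d"
proof -
  have "\<forall>(\<gamma>s, \<chi>) \<in> R'_PWK. (\<forall>\<gamma> \<in> set \<gamma>s. \<Gamma> \<turnstile>\<^sub>R s \<gamma> \<^bold>\<or> d) \<longrightarrow> \<Gamma> \<turnstile>\<^sub>R s \<chi> \<^bold>\<or> d"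
    if "substitution s" for s
    using that by (auto simp: Ball_R'_PWK substitution_def intro: side_formula_rules_context
        weakening[OF derives_excluded_middle] pwk.contraction_context disj_intro_left
        pwk.commute_context pwk.assoc_context)
  with assms show ?thesis unfolding rule_instance_def by fast
qed

interpretation pwk: disjunctive_calculus R'_PWK
  by unfold_locales (rule R'_PWK_rule_instance_context)

lemma relatively_maximal_pwk_saturated:
  assumes "relatively_maximal R'_PWK \<phi> M"
  shows "pwk_saturated M"
proof -
  have derives_iff: "M \<turnstile>\<^sub>R a \<longleftrightarrow> a \<in> M" for a
    using assms by (rule relatively_maximal_derives_iff)
  have disj_iff: "a \<^bold>\<or> b \<in> M \<longleftrightarrow> a \<in> M \<or> b \<in> M" for a b
    using assms by (rule pwk.relatively_maximal_prime)
  have side_formula: "M \<turnstile>\<^sub>R a \<^bold>\<or> \<phi> \<longleftrightarrow> a \<in> M" for a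
    using relatively_maximal_not_mem[OF assms] unfolding derives_iff disj_iff by blast
  have complete: "a \<in> M \<or> \<^bold>\<not> a \<in> M" for a
    using derives_excluded_middle[of M a] unfolding derives_iff disj_iff .
  show ?thesis
  proof
    fix a b
    show "a \<in> M \<or> \<^bold>\<not> a \<in> M" by (rule complete)
    show "\<^bold>\<not> \<^bold>\<not> a \<in> M \<longleftrightarrow> a \<in> M"
      using neg_neg_intro[of M a \<phi>] neg_neg_elim[of M a \<phi>] unfolding side_formula by blast
    show "a \<^bold>\<and> b \<in> M \<longleftrightarrow> a \<in> M \<and> b \<in> M \<or> a \<in> M \<and> \<^bold>\<not> a \<in> M \<or> b \<in> M \<and> \<^bold>\<not> b \<in> M"
      using conj_elim[of M a b \<phi>] conj_elim_right_neg[of M a b \<phi>] conj_elim_left_neg[of M a b \<phi>]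
        conj_intro[of M a \<phi> b] conj_intro_left_glut[of M a \<phi> b] conj_intro_right_glut[of M b \<phi> a]
      unfolding side_formula disj_iff by blast
    show "\<^bold>\<not> (a \<^bold>\<and> b) \<in> M \<longleftrightarrow> \<^bold>\<not> a \<in> M \<or> \<^bold>\<not> b \<in> M"
      using neg_conj_elim[of M a b \<phi>] neg_conj_intro_left[of M a \<phi> b]
        neg_conj_intro_right[of M b \<phi> a]
      unfolding side_formula disj_iff by blast
    show "a \<^bold>\<or> b \<in> M \<longleftrightarrow> a \<in> M \<or> b \<in> M" by (rule disj_iff)
    show "\<^bold>\<not> (a \<^bold>\<or> b) \<in> M \<longleftrightarrow>
        \<^bold>\<not> a \<in> M \<and> \<^bold>\<not> b \<in> M \<or> a \<in> M \<and> \<^bold>\<not> a \<in> M \<or> b \<in> M \<and> \<^bold>\<not> b \<in> M"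
      using neg_disj_elim[of M a b \<phi>] neg_disj_elim_right_neg[of M a b \<phi>]
        neg_disj_elim_left_neg[of M a b \<phi>] neg_disj_intro_left_glut[of M a \<phi> b]
        neg_disj_intro_right_glut[of M b \<phi> a] complete[of "a \<^bold>\<or> b"]
      unfolding side_formula disj_iff by blast
  qed
qed

theorem theorem6:
  fixes \<Gamma> :: "fm set" and \<phi> :: fm
  shows "derives R'_PWK \<Gamma> \<phi> \<longleftrightarrow> \<Gamma> \<turnstile>\<^sub>P\<^sub>W\<^sub>K \<phi>"
proof
  assume "\<Gamma> \<turnstile>\<^sub>R \<phi>"
  then show "\<Gamma> \<turnstile>\<^sub>P\<^sub>W\<^sub>K \<phi>" by (rule derives_sound[OF R'_PWK_schema_sound])
next
  assume consequence: "\<Gamma> \<turnstile>\<^sub>P\<^sub>W\<^sub>K \<phi>"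
  show "\<Gamma> \<turnstile>\<^sub>R \<phi>"
  proof (rule ccontr)
    assume "\<not> \<Gamma> \<turnstile>\<^sub>R \<phi>"
    then obtain M where "\<Gamma> \<subseteq> M" and M: "relatively_maximal R'_PWK \<phi> M"
      by (rule lindenbaum)
    have "\<not> \<Gamma> \<turnstile>\<^sub>P\<^sub>W\<^sub>K \<phi>"
      using relatively_maximal_pwk_saturated[OF M] \<open>\<Gamma> \<subseteq> M\<close> relatively_maximal_not_mem[OF M]
      by (rule pwk_saturated.not_pwk)
    with consequence show False by contradiction
  qed
qed

end
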